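(* For every real number $s>1$, $$ s - (1-\gamma)\frac{s-1}{s} - \frac{(s-1)^2}{s^2} < (s-1)\zeta(s) < s - (1-\gamma)\frac{s-1}{s} - \frac{(s-1)^2}{3 s^2}. $$
   Context: $\zeta$ denotes the Riemann zeta function and $\gamma = 0.57721\ldots$ denotes the Euler--Mascheroni constant. *)

theory Defs
  imports "HOL-Analysis.Analysis"
begin

text \<open>
  The Riemann zeta function on the real half-line of convergence \<open>s > 1\<close> of its Dirichlet series
  \<open>1 + 1/2^s + 1/3^s + \<dots>\<close>. Outside that half-line the value of the definition is meaningless
  (it is not the analytic continuation). The summation index is shifted, so that term \<open>n\<close> is
  \<open>1 / (n + 1)^s\<close>.
\<close>

definition riemann_zeta :: "real \<Rightarrow> real" where
  "riemann_zeta s = (\<Sum>n. 1 / real (Suc n) powr s)"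

lemma riemann_zeta_sums:
  assumes "s > 1"
  shows "(\<lambda>n. 1 / real (Suc n) powr s) sums riemann_zeta s"
proof -
  have "summable (\<lambda>n. real n powr (- s))"
    using assms by (simp add: summable_real_powr_iff)
  then have "summable (\<lambda>n. real (Suc n) powr (- s))"
    by (subst summable_Suc_iff)
  then have "summable (\<lambda>n. 1 / real (Suc n) powr s)"
    by (simp only: powr_minus_divide)
  then show ?thesis
    unfolding riemann_zeta_def by (rule summable_sums)
qed

end

theory Submission
  imports Defs
begin

text \<open>
  Write \<open>p = s - 1\<close> and \<open>g\<close> for the Euler--Mascheroni constant. Since
  \<open>\<zeta>(s) = 1/p + g + O(p)\<close> as \<open>p \<rightarrow> 0\<close>, all three members of the claim are \<open>1 + p g + O(p\<^sup>2)\<close>: the two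
  inequalities are tight to first order at \<open>s = 1\<close>. There they become a comparison of coefficients of
  \<open>p\<^sup>2\<close>: the coefficient of \<open>(s-1) \<zeta>(s)\<close> tends to about 0.0728, those of the two bounds to \<open>- g\<close> and to
  \<open>2/3 - g\<close>, which is about 0.0894. The upper bound is therefore the delicate one.

  Away from \<open>s = 1\<close> the sum \<open>\<zeta>(s)\<close> is compared with the integral of \<open>x powr (-s)\<close>, which is convex: the
  midpoint rule bounds \<open>\<zeta>(s)\<close> from above (\<open>zeta_le_midpoint\<close>), the trapezoidal rule from below
  (\<open>zeta_ge_trapezoid\<close>).

  Near \<open>s = 1\<close> any such numerical bound has an error that does not vanish with \<open>p\<close>. What has to be
  estimated is \<open>\<zeta>(s) - 1/p - g\<close>, to order \<open>p\<close>. This number is the limit of the difference between sum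
  and integral for the single function \<open>x powr (-s) - 1/x\<close>, whose size is itself of order \<open>p\<close>, so sum
  and integral are compared for that function. From \<open>x = 3\<close> on, \<open>1/x - x powr (-s)\<close> is decreasing, which
  gives the lower bound (\<open>zeta_ge_gamma_antimono\<close>). Near \<open>s = 1\<close> it is not convex from 3 on, but
  \<open>A/x - x powr (-s)\<close> is for a suitable \<open>A\<close> slightly above 1, such as \<open>A = 1 + 5p/12\<close>. The extra multiple of \<open>1/x\<close> costs
  only \<open>5p/12\<close> times the trapezoidal defect \<open>g - 5/3 + ln 3\<close> of \<open>1/x\<close>, which is below 0.01; this gives the
  upper bound (\<open>zeta_le_gamma_trapezoid\<close>).

  After that only powers \<open>a powr (-p)\<close> with \<open>a = 3/2, 2, 3\<close> are left. Bounding them by Taylor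
  polynomials, or by the reciprocal of one, turns each of the four estimates into polynomial
  inequalities in one variable.
\<close>

section \<open>Sums compared with integrals\<close>

text \<open>
  A convex function lies below its chord. Integrals appear through an antiderivative \<open>F\<close> here and
  below, so that no integrability has to be discussed.
\<close>
lemma integral_le_trapezoid_of_convex:
  fixes f F :: "real \<Rightarrow> real"
  assumes "a < b" and F: "\<And>x. x \<in> {a..b} \<Longrightarrow> (F has_real_derivative f x) (at x)"
    and cvx: "convex_on {a..b} f"
  shows "F b - F a \<le> (b - a) * (f a + f b) / 2"
proof -
  define m where "m = (f b - f a) / (b - a)"
  \<comment> \<open>\<open>D\<close> is an antiderivative of the chord minus \<open>F\<close>.\<close>
  define D where "D = (\<lambda>x. f a * (x - a) + m * (x - a)^2 / 2 - F x)"
  have "D a \<le> D b"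
  proof (rule DERIV_nonneg_imp_nondecreasing[where f = D])
    fix x assume x: "a \<le> x" "x \<le> b"
    have "(D has_real_derivative f a + m * (x - a) - f x) (at x)"
      unfolding D_def using x by (auto intro!: derivative_eq_intros F)
    moreover have "f x \<le> f a + m * (x - a)"
      using convex_onD_Icc'[OF cvx, of x] x by (simp add: m_def)
    ultimately show "\<exists>y. (D has_real_derivative y) (at x) \<and> y \<ge> 0" by force
  qed (use assms in simp)
  moreover have "m * (b - a)^2 = (f b - f a) * (b - a)"
    using \<open>a < b\<close> by (simp add: m_def power2_eq_square)
  ultimately show ?thesis by (simp add: D_def field_simps)
qed

text \<open>
  The difference of the two sides vanishes for \<open>h = 0\<close>, and its derivative in \<open>h\<close> is
  \<open>f (a + h) + f (a - h) - 2 * f a\<close>, which is nonnegative by convexity.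
\<close>
lemma midpoint_le_integral_of_convex:
  fixes f F :: "real \<Rightarrow> real"
  assumes "h \<ge> 0" and F: "\<And>x. x \<in> {a-h..a+h} \<Longrightarrow> (F has_real_derivative f x) (at x)"
    and cvx: "convex_on {a-h..a+h} f"
  shows "2 * h * f a \<le> F (a + h) - F (a - h)"
proof -
  define D where "D = (\<lambda>t. F (a + t) - F (a - t) - 2 * t * f a)"
  have "D 0 \<le> D h"
  proof (rule DERIV_nonneg_imp_nondecreasing[where f = D])
    fix t assume t: "0 \<le> t" "t \<le> h"
    have "((\<lambda>t. F (a + t)) has_real_derivative f (a + t) * 1) (at t)"
      by (rule DERIV_chain2[OF F]) (use t in \<open>auto intro!: derivative_eq_intros\<close>)
    moreover have "((\<lambda>t. F (a - t)) has_real_derivative f (a - t) * (- 1)) (at t)"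
      by (rule DERIV_chain2[OF F]) (use t in \<open>auto intro!: derivative_eq_intros\<close>)
    ultimately have "(D has_real_derivative f (a + t) + f (a - t) - 2 * f a) (at t)"
      unfolding D_def by (auto intro!: derivative_eq_intros)
    moreover have "(1 - 1/2) *\<^sub>R (a + t) + (1/2) *\<^sub>R (a - t) = a"
      by (simp add: field_simps)
    with convex_onD[OF cvx, of "1/2" "a + t" "a - t"] t
    have "2 * f a \<le> f (a + t) + f (a - t)" by (simp add: field_simps)
    ultimately show "\<exists>y. (D has_real_derivative y) (at t) \<and> y \<ge> 0" by force
  qed (use assms in simp)
  then show ?thesis by (simp add: D_def)
qed

text \<open>
  In this lemma and the next two, \<open>l\<close> is the Euler constant of \<open>f\<close>: the limit of sum minus
  integral, as the Euler--Mascheroni constant is for \<open>1/x\<close>. With half of the last term removed, sum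
  minus integral changes from \<open>n\<close> to \<open>n + 1\<close> by the error of one trapezoid, so it increases to the
  limit.
\<close>
lemma trapezoid_le_euler_constant:
  fixes f F :: "real \<Rightarrow> real"
  assumes F: "\<And>x. x \<ge> real N \<Longrightarrow> (F has_real_derivative f x) (at x)"
    and cvx: "convex_on {real N..} f"
    and lim: "(\<lambda>n. (\<Sum>k=1..n. f (real k)) - F (real n)) \<longlonglongrightarrow> l"
    and f0: "(\<lambda>n. f (real n)) \<longlonglongrightarrow> 0"
  shows "(\<Sum>k=1..N. f (real k)) - F (real N) - f (real N) / 2 \<le> l"
proof -
  define Q where "Q n = (\<Sum>k=1..n. f (real k)) - F (real n) - f (real n) / 2" for n
  have step: "Q n \<le> Q (Suc n)" if "n \<ge> N" for n
  proof -
    have "F (real (Suc n)) - F (real n) \<le> (real (Suc n) - real n) * (f (real n) + f (real (Suc n))) / 2"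
      by (rule integral_le_trapezoid_of_convex)
        (use that in \<open>auto intro!: F convex_on_subset[OF cvx]\<close>)
    then show ?thesis by (simp add: Q_def field_simps)
  qed
  have "Q N \<le> Q n" if "n \<ge> N" for n
    using that by (induction n rule: dec_induct) (auto intro: order_trans step)
  moreover have "Q \<longlonglongrightarrow> l - 0 / 2"
    unfolding Q_def by (intro tendsto_intros lim f0) auto
  ultimately show ?thesis
    using LIMSEQ_le_const[of Q "l - 0/2" "Q N"] by (auto simp: Q_def)
qed

text \<open>
  Stopping the integral at \<open>n + 1/2\<close> makes sum minus integral decrease, because each new term is the
  midpoint approximation of the integral over an interval of length 1 centred at it.
\<close>
lemma euler_constant_le_midpoint:
  fixes f F :: "real \<Rightarrow> real"
  assumes F: "\<And>x. x \<ge> real N + 1/2 \<Longrightarrow> (F has_real_derivative f x) (at x)"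
    and cvx: "convex_on {real N + 1/2..} f"
    and lim: "(\<lambda>n. (\<Sum>k=1..n. f (real k)) - F (real n + 1/2)) \<longlonglongrightarrow> l"
  shows "l \<le> (\<Sum>k=1..N. f (real k)) - F (real N + 1/2)"
proof -
  define Q where "Q n = (\<Sum>k=1..n. f (real k)) - F (real n + 1/2)" for n
  have step: "Q (Suc n) \<le> Q n" if "n \<ge> N" for n
  proof -
    have "2 * (1/2) * f (real (Suc n)) \<le> F (real (Suc n) + 1/2) - F (real (Suc n) - 1/2)"
      by (rule midpoint_le_integral_of_convex)
        (use that in \<open>auto intro!: F convex_on_subset[OF cvx]\<close>)
    then show ?thesis by (simp add: Q_def field_simps)
  qed
  have "Q n \<le> Q N" if "n \<ge> N" for n
    using that by (induction n rule: dec_induct) (auto intro: order_trans step)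
  then show ?thesis
    using LIMSEQ_le_const2[of Q l "Q N"] lim unfolding Q_def by blast
qed

lemma euler_constant_le_of_antimono:
  fixes f F :: "real \<Rightarrow> real"
  assumes F: "\<And>x. x \<ge> real N \<Longrightarrow> (F has_real_derivative f x) (at x)"
    and anti: "\<And>x y. real N \<le> x \<Longrightarrow> x \<le> y \<Longrightarrow> f y \<le> f x"
    and lim: "(\<lambda>n. (\<Sum>k=1..n. f (real k)) - F (real n)) \<longlonglongrightarrow> l"
  shows "l \<le> (\<Sum>k=1..N. f (real k)) - F (real N)"
proof -
  define Q where "Q n = (\<Sum>k=1..n. f (real k)) - F (real n)" for n
  have step: "Q (Suc n) \<le> Q n" if n: "n \<ge> N" for n
  proof -
    obtain z where z: "z > real n" "z < real (Suc n)"
      "F (real (Suc n)) - F (real n) = (real (Suc n) - real n) * f z"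
      using MVT2[of "real n" "real (Suc n)" F f] F n by auto
    moreover have "f (real (Suc n)) \<le> f z" using z n by (intro anti) auto
    ultimately show ?thesis by (simp add: Q_def field_simps)
  qed
  have "Q n \<le> Q N" if "n \<ge> N" for n
    using that by (induction n rule: dec_induct) (auto intro: order_trans step)
  then show ?thesis
    using LIMSEQ_le_const2[of Q l "Q N"] lim unfolding Q_def by blast
qed

section \<open>Bounds for the zeta function\<close>

text \<open>
  The functions \<open>c / x + d * x powr (- s)\<close> are the ones to which the comparison applies; their Euler
  constant is \<open>c * euler_mascheroni + d * riemann_zeta s\<close>, by \<open>harm_zeta_limit\<close> below. The antiderivative
  is normalised so that its second summand vanishes at infinity.
\<close>
lemma harm_zeta_antiderivative:
  fixes c d s x :: real
  assumes "s > 1" "x > 0"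
  shows "((\<lambda>x. c * ln x - d * x powr (1 - s) / (s - 1)) has_real_derivative (c / x + d * x powr (- s))) (at x)"
proof -
  have "((\<lambda>x. c * ln x - d / (s - 1) * x powr (1 - s)) has_real_derivative
      c * (1 / x) - d / (s - 1) * ((1 - s) * x powr (- s))) (at x)"
    using assms by (auto intro!: derivative_eq_intros)
  moreover have "d / (s - 1) * (1 - s) = - d"
    using assms by (simp add: field_simps)
  then have "c * (1 / x) - d / (s - 1) * ((1 - s) * x powr (- s)) = c / x + d * x powr (- s)"
    by (simp only: mult.assoc[symmetric]) simp
  ultimately have "((\<lambda>x. c * ln x - d / (s - 1) * x powr (1 - s)) has_real_derivative
      c / x + d * x powr (- s)) (at x)"
    by (simp only:)
  then show ?thesis by simp
qed

lemma harm_zeta_convex: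
  fixes c d s N :: real
  assumes "N > 0" "s > 1"
    and "\<And>x. x \<ge> N \<Longrightarrow> 0 \<le> 2 * c + d * s * (s + 1) * x powr (1 - s)"
  shows "convex_on {N..} (\<lambda>x. c / x + d * x powr (- s))"
proof (rule f''_ge0_imp_convex)
  fix x assume "x \<in> {N..}"
  then have x: "x > 0" "x \<ge> N" using assms by auto
  show "((\<lambda>x. c / x + d * x powr (- s)) has_real_derivative
      - c / x^2 - d * s * x powr (- s - 1)) (at x)"
    using x by (auto intro!: derivative_eq_intros simp: power2_eq_square)
  show "((\<lambda>x. - c / x^2 - d * s * x powr (- s - 1)) has_real_derivative
      (2 * c + d * s * (s + 1) * x powr (1 - s)) / x^3) (at x)"
  proof -
    have e: "x powr (- s - 1 - 1) = x powr (1 - s) / x^3"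
      using x powr_diff[of x "1 - s" 3] by (simp add: powr_numeral)
    have "((\<lambda>x. - c / x^2 - d * s * x powr (- s - 1)) has_real_derivative
        2 * c / x^3 - d * s * ((- s - 1) * x powr (- s - 1 - 1))) (at x)"
      using x by (auto intro!: derivative_eq_intros simp: power2_eq_square power3_eq_cube mult_ac)
    also have "2 * c / x^3 - d * s * ((- s - 1) * x powr (- s - 1 - 1)) =
        (2 * c + d * s * (s + 1) * x powr (1 - s)) / x^3"
      unfolding e using x by (simp add: field_simps)
    finally show ?thesis .
  qed
  show "0 \<le> (2 * c + d * s * (s + 1) * x powr (1 - s)) / x^3"
    using assms x by simp
qed simp

lemma harm_zeta_limit:
  fixes c d s :: real
  assumes "s > 1"
  shows "(\<lambda>n. (\<Sum>k=1..n. c / real k + d * real k powr (- s))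
            - (c * ln (real n) - d * real n powr (1 - s) / (s - 1)))
         \<longlonglongrightarrow> c * euler_mascheroni + d * riemann_zeta s"
proof -
  have "(\<lambda>n. \<Sum>k<n. 1 / real (Suc k) powr s) \<longlonglongrightarrow> riemann_zeta s"
    using riemann_zeta_sums[OF assms] by (simp add: sums_def)
  moreover have "(\<Sum>k<n. 1 / real (Suc k) powr s) = (\<Sum>k=1..n. real k powr (- s))" for n
    by (rule sum.reindex_bij_witness[of _ "\<lambda>k. k - 1" Suc]) (auto simp: powr_minus_divide)
  ultimately have z: "(\<lambda>n. \<Sum>k=1..n. real k powr (- s)) \<longlonglongrightarrow> riemann_zeta s" by simp
  have p: "(\<lambda>n. real n powr (1 - s)) \<longlonglongrightarrow> 0"
    using assms by (intro tendsto_neg_powr filterlim_real_sequentially) auto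
  have "(\<lambda>n. c * (harm n - ln (real n)) + d * (\<Sum>k=1..n. real k powr (- s))
      + d * real n powr (1 - s) / (s - 1))
      \<longlonglongrightarrow> c * euler_mascheroni + d * riemann_zeta s + d * 0 / (s - 1)"
    by (intro tendsto_intros z p euler_mascheroni_LIMSEQ) (use assms in auto)
  then show ?thesis
    by (simp add: harm_def sum.distrib sum_distrib_left algebra_simps divide_inverse)
qed

lemma harm_zeta_tendsto_0:
  fixes c d s :: real
  assumes "s > 1"
  shows "(\<lambda>n. c / real n + d * real n powr (- s)) \<longlonglongrightarrow> 0"
proof -
  have p: "(\<lambda>n. real n powr (- s)) \<longlonglongrightarrow> 0"
    using assms by (intro tendsto_neg_powr filterlim_real_sequentially) auto
  have "(\<lambda>n. c / real n + d * real n powr (- s)) \<longlonglongrightarrow> 0 + d * 0"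
    by (intro tendsto_intros p lim_const_over_n)
  then show ?thesis by simp
qed

lemma zeta_le_midpoint:
  assumes "s > 1"
  shows "riemann_zeta s \<le> 1 + (3/2) powr (1 - s) / (s - 1)"
proof -
  define F where "F x = - (x powr (1 - s) / (s - 1))" for x :: real
  have "(\<lambda>n. (\<Sum>k=1..n. real k powr (- s)) - F (real n)) \<longlonglongrightarrow> riemann_zeta s"
    using harm_zeta_limit[OF assms, of 0 1] by (simp add: F_def)
  moreover have "(F \<longlongrightarrow> 0) at_top"
    unfolding F_def using assms
    by (auto intro!: tendsto_neg_powr filterlim_ident tendsto_divide_zero tendsto_minus[where a = 0, simplified])
  then have "(\<lambda>n. F (real n)) \<longlonglongrightarrow> 0" "(\<lambda>n. F (real n + 1/2)) \<longlonglongrightarrow> 0"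
    by (rule filterlim_compose;
        intro filterlim_at_top_mono[OF filterlim_real_sequentially always_eventually]; simp)+
  ultimately have "(\<lambda>n. ((\<Sum>k=1..n. real k powr (- s)) - F (real n)) + F (real n) - F (real n + 1/2))
      \<longlonglongrightarrow> riemann_zeta s + 0 - 0"
    by (intro tendsto_intros)
  then have "riemann_zeta s \<le> (\<Sum>k=1..1. real k powr (- s)) - F (real 1 + 1/2)"
  proof (intro euler_constant_le_midpoint)
    show "(F has_real_derivative x powr (- s)) (at x)" if "x \<ge> real 1 + 1/2" for x
      using harm_zeta_antiderivative[OF assms, of x 0 1] that by (simp add: F_def[abs_def])
    show "convex_on {real 1 + 1/2..} (\<lambda>x. x powr (- s))"
      using harm_zeta_convex[OF _ assms, of "real 1 + 1/2" 0 1] assms by simp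
  qed simp
  then show ?thesis by (simp add: F_def)
qed

text \<open>
  The trapezoidal rule from 1 on would give only \<open>1/2 + 1 / (s - 1)\<close>, which stays too small as
  \<open>s\<close> grows; keeping the first term of the series exact repairs this.
\<close>
lemma zeta_ge_trapezoid:
  assumes "s > 1"
  shows "riemann_zeta s \<ge> 1 + 2 powr (- s) / 2 + 2 powr (1 - s) / (s - 1)"
proof -
  have "convex_on {real 2..} (\<lambda>x. 0 / x + 1 * x powr (- s))"
    by (rule harm_zeta_convex) (use assms in auto)
  then have "(\<Sum>k=1..2. 0 / real k + 1 * real k powr (- s))
      - (0 * ln (real 2) - 1 * real 2 powr (1 - s) / (s - 1)) - (0 / real 2 + 1 * real 2 powr (- s)) / 2
      \<le> 0 * euler_mascheroni + 1 * riemann_zeta s"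
    by (rule trapezoid_le_euler_constant[rotated])
      (use assms in \<open>intro harm_zeta_antiderivative harm_zeta_limit harm_zeta_tendsto_0; simp\<close>)+
  then show ?thesis by (simp add: numeral_2_eq_2)
qed

text \<open>
  The hypothesis on \<open>A\<close> says that the second derivative of \<open>A / x - x powr (- s)\<close> is nonnegative at 3,
  hence beyond 3. The Euler constant of this function, \<open>A * euler_mascheroni - riemann_zeta s\<close>, is then
  at least its trapezoidal approximation of order 3. The factor of \<open>A\<close> in the result is the amount by
  which the Euler--Mascheroni constant exceeds the approximation \<open>5/3 - ln 3\<close> of the same kind.
\<close>
lemma zeta_le_gamma_trapezoid:
  assumes "s > 1" "2 * A * 3 powr (s - 1) \<ge> s * (s + 1)"
  shows "riemann_zeta s \<le> 1 + 2 powr (- s) + 3 powr (- s) / 2 + 3 powr (1 - s) / (s - 1)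
    + A * (euler_mascheroni - 5/3 + ln 3)"
proof -
  have A: "0 \<le> 2 * A + (- 1) * s * (s + 1) * x powr (1 - s)" if "x \<ge> 3" for x
  proof -
    have A0: "A \<ge> 0"
    proof (rule ccontr)
      assume "\<not> A \<ge> 0"
      then have "2 * A * 3 powr (s - 1) < 0" by (simp add: mult_neg_pos)
      moreover have "s * (s + 1) > 0" using assms(1) by (intro mult_pos_pos) auto
      ultimately show False using assms(2) by linarith
    qed
    have "s * (s + 1) \<le> 2 * A * 3 powr (s - 1)" by fact
    also have "\<dots> \<le> 2 * A * x powr (s - 1)"
      using A0 that assms by (intro mult_left_mono powr_mono2) auto
    finally have "s * (s + 1) * x powr (1 - s) \<le> 2 * A * x powr (s - 1) * x powr (1 - s)"
      by (intro mult_right_mono) auto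
    also have "\<dots> = 2 * A" using that by (simp add: powr_add[symmetric])
    finally show ?thesis by simp
  qed
  have "(\<Sum>k=1..3. A / real k + (- 1) * real k powr (- s))
      - (A * ln (real 3) - (- 1) * real 3 powr (1 - s) / (s - 1)) - (A / real 3 + (- 1) * real 3 powr (- s)) / 2
      \<le> A * euler_mascheroni + (- 1) * riemann_zeta s"
  proof (rule trapezoid_le_euler_constant)
    show "convex_on {real 3..} (\<lambda>x. A / x + (- 1) * x powr (- s))"
      by (rule harm_zeta_convex) (use A assms in auto)
  qed (use assms in \<open>intro harm_zeta_antiderivative harm_zeta_limit harm_zeta_tendsto_0; simp\<close>)+
  then show ?thesis by (simp add: numeral_3_eq_3 algebra_simps diff_divide_distrib)
qed

text \<open>
  The function \<open>1/x - x powr (- s)\<close> decreases where \<open>s \<le> x powr (s - 1)\<close>, in particular for \<open>x \<ge> exp 1\<close>,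
  whatever \<open>s > 1\<close> is. This is why the sum is split at 3.
\<close>
lemma zeta_ge_gamma_antimono:
  assumes "s > 1"
  shows "riemann_zeta s \<ge> euler_mascheroni - 5/6 + ln 3 + 2 powr (- s) + 3 powr (- s)
    + 3 powr (1 - s) / (s - 1)"
proof -
  have "1 * euler_mascheroni + (- 1) * riemann_zeta s
      \<le> (\<Sum>k=1..3. 1 / real k + (- 1) * real k powr (- s))
      - (1 * ln (real 3) - (- 1) * real 3 powr (1 - s) / (s - 1))"
  proof (rule euler_constant_le_of_antimono)
    fix x y :: real assume xy: "real 3 \<le> x" "x \<le> y"
    show "1 / y + (- 1) * y powr (- s) \<le> 1 / x + (- 1) * x powr (- s)"
    proof (rule DERIV_nonpos_imp_nonincreasing[where f = "\<lambda>x. 1 / x + (- 1) * x powr (- s)"])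
      fix z assume z: "x \<le> z" "z \<le> y"
      \<comment> \<open>\<open>z powr (s - 1) \<ge> 1 + (s - 1) * ln z \<ge> s\<close> because \<open>ln z \<ge> 1\<close>.\<close>
      have "exp 1 \<le> z" using exp_le z xy by simp
      then have "ln z \<ge> 1" using z xy by (subst ln_ge_iff) auto
      then have "(s - 1) * 1 \<le> (s - 1) * ln z" using assms by (intro mult_left_mono) auto
      then have "s \<le> 1 + (s - 1) * ln z" by simp
      also have "\<dots> \<le> z powr (s - 1)"
        using z xy exp_ge_add_one_self[of "(s - 1) * ln z"] by (simp add: powr_def)
      finally have "s * z powr (- s - 1) \<le> z powr (s - 1) * z powr (- s - 1)"
        by (intro mult_right_mono) auto
      also have "\<dots> = 1 / z^2"
        using z xy by (simp add: powr_add[symmetric] powr_minus_divide)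
      finally have "- 1 / z^2 + s * z powr (- s - 1) \<le> 0" by simp
      moreover have "((\<lambda>x. 1 / x + (- 1) * x powr (- s)) has_real_derivative
          - 1 / z^2 + s * z powr (- s - 1)) (at z)"
        using z xy by (auto intro!: derivative_eq_intros simp: power2_eq_square)
      ultimately show "\<exists>y. ((\<lambda>x. 1 / x + (- 1) * x powr (- s)) has_real_derivative y) (at z) \<and> y \<le> 0"
        by blast
    qed fact
  qed (use assms in \<open>intro harm_zeta_antiderivative harm_zeta_limit; simp\<close>)+
  then show ?thesis by (simp add: numeral_3_eq_3)
qed

section \<open>Elementary estimates\<close>

lemma ln2_bounds: "ln 2 \<in> {0.69314..0.69315::real}"
  using ln_approx_bounds[of 2 5] by (simp add: eval_nat_numeral)
lemma ln3_bounds: "ln 3 \<in> {1.0986..1.0987::real}"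
  using ln_approx_bounds[of 3 7] by (simp add: eval_nat_numeral)
lemma ln32_bounds: "ln (3/2) \<in> {0.4054..0.4055::real}"
  using ln_approx_bounds[of "3/2" 4] by (simp add: eval_nat_numeral)

text \<open>
  The index 31 is chosen because the resulting bounds involve only \<open>ln 32 = 5 * ln 2\<close>; the upper
  bound 0.578 is needed with nearly this accuracy in \<open>upper_estimate_near_1\<close>.
\<close>
lemma gamma_bounds: "euler_mascheroni \<in> {0.577..0.578::real}"
proof -
  have "ln 32 = 5 * ln (2::real)" using ln_realpow[of 2 5] by simp
  then show ?thesis
    using euler_mascheroni_bounds[of 31] ln2_bounds by (simp add: harm_expand)
qed

text \<open>
  The sign of the Lagrange remainder alternates with the order.
\<close>
lemma exp_minus_Taylor_enclosure:
  fixes y :: real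
  assumes "y \<ge> 0" "even n"
  shows "(\<Sum>m<n. (- y) ^ m / fact m) \<le> exp (- y)"
    and "exp (- y) \<le> (\<Sum>m<Suc n. (- y) ^ m / fact m)"
proof -
  obtain t where "exp (- y) = (\<Sum>m<n. (- y) ^ m / fact m) + exp t / fact n * (- y) ^ n"
    using Maclaurin_exp_le[of "- y" n] by blast
  then show "(\<Sum>m<n. (- y) ^ m / fact m) \<le> exp (- y)"
    using assms by (simp add: zero_le_even_power)
  obtain t where "exp (- y) = (\<Sum>m<Suc n. (- y) ^ m / fact m) + exp t / fact (Suc n) * (- y) ^ Suc n"
    using Maclaurin_exp_le[of "- y" "Suc n"] by blast
  moreover have "exp t / fact (Suc n) * (- y) ^ Suc n \<le> 0"
    using assms by (intro mult_nonneg_nonpos) auto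
  ultimately show "exp (- y) \<le> (\<Sum>m<Suc n. (- y) ^ m / fact m)" by linarith
qed

lemma powr_minus_Taylor:
  fixes a p :: real
  assumes "a \<ge> 1" "p \<ge> 0"
  defines "y \<equiv> p * ln a"
  shows "a powr (- p) \<le> 1 - y + y^2 / 2"
    "a powr (- p) \<ge> 1 - y + y^2 / 2 - y^3 / 6"
    "a powr (- p) \<le> 1 - y + y^2 / 2 - y^3 / 6 + y^4 / 24"
proof -
  have "y \<ge> 0" "a powr (- p) = exp (- y)" "even (4::nat)"
    using assms by (auto simp: powr_def)
  then show "a powr (- p) \<le> 1 - y + y^2 / 2"
    "a powr (- p) \<ge> 1 - y + y^2 / 2 - y^3 / 6"
    "a powr (- p) \<le> 1 - y + y^2 / 2 - y^3 / 6 + y^4 / 24"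
    using exp_minus_Taylor_enclosure[of y 2] exp_minus_Taylor_enclosure[of y 4]
    by (simp_all add: lessThan_nat_numeral fact_numeral power2_eq_square power3_eq_cube power4_eq_xxxx algebra_simps)
qed

text \<open>
  Here \<open>(3/2) powr (- p)\<close> needs an upper bound that decays at infinity, so it is bounded by the
  reciprocal of a quadratic Taylor polynomial. At \<open>p = 2/5\<close> the slack is small, and at
  \<open>p = 1/3\<close> the inequality fails for the Euler--Mascheroni constant \<open>g\<close>.
\<close>
lemma upper_estimate_away_from_1:
  fixes p g :: real
  assumes "p \<ge> 2/5" "g \<ge> 0.577"
  shows "(3/2) powr (- p) < 1 - (1 - g) * (p / (1 + p)) - p^2 / (3 * (1 + p)^2)"
proof -
  define q where "q = 1 + 0.4054 * p + 0.0821 * p^2"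
  have q: "q > 0" using assms by (simp add: q_def add_pos_nonneg)
  have y: "p * ln (3/2) \<ge> p * 0.4054" using ln32_bounds assms by (intro mult_left_mono) auto
  have "(p * 0.4054)^2 \<le> (p * ln (3/2))^2" using y assms by (intro power_mono) auto
  have "q \<le> 1 + p * ln (3/2) + (p * ln (3/2))^2 / 2"
  proof -
    have "0.0821 * p^2 \<le> (p * 0.4054)^2 / 2"
      by (simp add: power_mult_distrib power_divide mult_le_cancel_right)
    also have "\<dots> \<le> (p * ln (3/2))^2 / 2" using \<open>(p * 0.4054)^2 \<le> (p * ln (3/2))^2\<close> by (rule divide_right_mono) simp
    finally show ?thesis using y unfolding q_def by simp
  qed
  also have "\<dots> \<le> (3/2) powr p"
    using exp_lower_Taylor_quadratic[of "p * ln (3/2)"] assms by (simp add: powr_def)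
  finally have "(3/2) powr (- p) \<le> 1 / q"
    using q by (simp add: powr_minus_divide frac_le)
  also have "1 / q < 1 - 0.423 * (p / (1 + p)) - p^2 / (3 * (1 + p)^2)"
  proof -
    have "p^2 \<ge> 2/5 * p" using assms by (simp add: power2_eq_square)
    then have "0 < 228/1000 * p^2 - 35/1000 * p - 177/10000" using assms(1) by linarith
    \<comment> \<open>Cleared of denominators, the claim is the positivity of a polynomial divisible by \<open>p\<close>. The
      second summand below is what remains after the decimals have been rounded.\<close>
    then have "0 < p * (0.228 * p^2 - 0.035 * p - 0.0177)" using assms by simp
    also have "\<dots> \<le> p * (0.228 * p^2 - 0.035 * p - 0.0177)
        + p * (1/10000 + 1237/15000000 * p + 61/240000 * p^2 + 600151/30000000 * p^3)"
      using assms by simp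
    also have "\<dots> = (1+p)^2 * q - (1+p)^2 - 0.423 * p * (1+p) * q - p^2 / 3 * q"
      unfolding q_def by algebra
    finally have "0 < ((1+p)^2 * q - (1+p)^2 - 0.423 * p * (1+p) * q - p^2 / 3 * q) / ((1+p)^2 * q)"
      using q assms by simp
    also have "\<dots> = 1 - 1/q - 0.423 * (p / (1 + p)) - p^2 / (3 * (1 + p)^2)"
      using q assms by (simp add: divide_simps) (simp add: algebra_simps power2_eq_square)
    finally show ?thesis by simp
  qed
  also have "(1 - g) * (p / (1 + p)) \<le> 0.423 * (p / (1 + p))"
    using assms by (intro mult_right_mono) auto
  then have "1 - 0.423 * (p / (1 + p)) - p^2 / (3 * (1 + p)^2) \<le> 1 - (1 - g) * (p / (1 + p)) - p^2 / (3 * (1 + p)^2)"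
    by simp
  finally show ?thesis .
qed

text \<open>
  Isolating \<open>1 + p * g\<close> reduces the estimates near \<open>p = 0\<close> to the coefficient of \<open>p\<^sup>2\<close>.
\<close>
lemma target_expansion:
  fixes p g c :: real
  assumes "p > 0"
  shows "1 + p - (1 - g) * (p / (1 + p)) - c * (p^2 / (1 + p)^2)
     = 1 + p * g + p^2 * ((1 - g) / (1 + p) - c / (1 + p)^2)"
  using assms by (simp add: divide_simps) algebra

text \<open>
  After cancellation of \<open>1 + p * g\<close>, the coefficient of \<open>p\<^sup>2\<close> is at most about 0.0877 on the left and at
  least about 0.0887 on the right, where the infimum is approached as \<open>p \<rightarrow> 0\<close>. The constant 0.0884
  separates them. The only power whose error is not multiplied by \<open>p\<close> is the isolated
  \<open>3 powr (- p)\<close>; it needs the Taylor polynomial of order 4, the others that of order 2.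
\<close>
lemma upper_estimate_near_1:
  fixes p g :: real
  assumes "0 < p" "p \<le> 2/5" "g \<in> {0.577..0.578}"
  shows "p + p * 2 powr (- p) / 2 + p * 3 powr (- p) / 6 + 3 powr (- p)
      + p * (1 + 5/12 * p) * (g - 5/3 + ln 3)
    < 1 + p - (1 - g) * (p / (1 + p)) - 1/3 * (p^2 / (1 + p)^2)"
proof -
  define l L :: real where "l = ln 2" and "L = ln 3"
  have lL: "0.69314 \<le> l" "l \<le> 0.69315" "1.0986 \<le> L" "L \<le> 1.0987"
    using ln2_bounds ln3_bounds by (auto simp: l_def L_def)
  have pows: "l^2 \<le> 0.69315^2" "L^2 \<le> 1.0987^2" "1.0986^3 \<le> L^3" "L^4 \<le> 1.0987^4"
    using lL by (intro power_mono; simp)+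
  have "p * 2 powr (- p) \<le> p * (1 - p * l + (p * l)^2 / 2)"
    using powr_minus_Taylor(1)[of 2 p] assms by (intro mult_left_mono) (auto simp: l_def)
  moreover have "p * 3 powr (- p) \<le> p * (1 - p * L + (p * L)^2 / 2)"
    using powr_minus_Taylor(1)[of 3 p] assms by (intro mult_left_mono) (auto simp: L_def)
  moreover have "3 powr (- p) \<le> 1 - p * L + (p * L)^2 / 2 - (p * L)^3 / 6 + (p * L)^4 / 24"
    using powr_minus_Taylor(3)[of 3 p] assms by (auto simp: L_def)
  ultimately have "p + p * 2 powr (- p) / 2 + p * 3 powr (- p) / 6 + 3 powr (- p)
      + p * (1 + 5/12 * p) * (g - 5/3 + ln 3)
    \<le> p + p * (1 - p * l + (p * l)^2 / 2) / 2 + p * (1 - p * L + (p * L)^2 / 2) / 6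
      + (1 - p * L + (p * L)^2 / 2 - (p * L)^3 / 6 + (p * L)^4 / 24)
      + p * (1 + 5/12 * p) * (g - 5/3 + L)"
    unfolding L_def by linarith
  also have "\<dots> = 1 + p * g + p^2 * (- l / 2 - L / 6 + L^2 / 2
      + p * (l^2 / 4 + L^2 / 12 - L^3 / 6) + p^2 * L^4 / 24 + 5/12 * (g - 5/3 + L))"
    by (simp add: algebra_simps eval_nat_numeral add_divide_distrib diff_divide_distrib)
  also have "\<dots> < 1 + p * g + p^2 * ((1 - g) / (1 + p) - (1/3) / (1 + p)^2)"
  proof -
    have total: "- l / 2 - L / 6 + L^2 / 2 + T + U / 24 + 5/12 * (g - 5/3 + L) < 0.0884"
      if "T \<le> p * 0.0001" "U \<le> (2/5)^2 * 1.0987^4" for T U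
    proof -
      have "g \<le> 0.578" using assms by simp
      with that pows lL assms(1,2) show ?thesis by (simp add: power_divide field_simps)
    qed
    have "l^2 / 4 + L^2 / 12 - L^3 / 6 \<le> 0.0001" using pows by (simp add: power_divide)
    then have "p * (l^2 / 4 + L^2 / 12 - L^3 / 6) \<le> p * 0.0001"
      using assms by (intro mult_left_mono) auto
    moreover have "p^2 * L^4 \<le> (2/5)^2 * 1.0987^4"
      using pows power_mono[of p "2/5" 2] assms by (intro mult_mono) auto
    ultimately have "- l / 2 - L / 6 + L^2 / 2
      + p * (l^2 / 4 + L^2 / 12 - L^3 / 6) + p^2 * L^4 / 24 + 5/12 * (g - 5/3 + L) < 0.0884"
      by (rule total)
    also have "0.0884 \<le> (1 - g) / (1 + p) - (1/3) / (1 + p)^2"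
    proof -
      have "p^2 \<le> 2/5 * p" using assms by (simp add: power2_eq_square)
      then have "884/10000 * p^2 + 1768/10000 * p + 884/10000 \<le> 422/1000 * p + 422/1000 - 1/3"
        using assms(1) by linarith
      then have "0.0884 * (1 + p)^2 \<le> 0.422 * (1 + p) - 1/3"
        by (simp add: power2_sum field_simps)
      also have "\<dots> \<le> (1 - g) * (1 + p) - 1/3"
        using assms by (intro diff_right_mono mult_right_mono) auto
      finally have "0.0884 \<le> ((1 - g) * (1 + p) - 1/3) / (1 + p)^2"
        using assms by (simp add: pos_le_divide_eq)
      also have "\<dots> = (1 - g) / (1 + p) - (1/3) / (1 + p)^2"
        using assms by (simp add: diff_divide_distrib power2_eq_square)
      finally show ?thesis .
    qed
    finally show ?thesis using assms by simp
  qed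
  finally show ?thesis using target_expansion[of p g "1/3"] assms by simp
qed

text \<open>
  After cancellation of \<open>1 + p * g\<close>, the constant \<open>- 0.12\<close> separates the coefficients of \<open>p\<^sup>2\<close>: about
  \<open>- 0.16\<close> at most on the left, about \<open>- 0.11\<close> at least on the right.
\<close>
lemma lower_estimate_near_1:
  fixes p g :: real
  assumes "0 < p" "p \<le> 1/2" "g \<ge> 0.577"
  shows "1 + p - (1 - g) * (p / (1 + p)) - 1 * (p^2 / (1 + p)^2)
    < p * (g - 5/6 + ln 3) + p * 2 powr (- p) / 2 + p * 3 powr (- p) / 3 + 3 powr (- p)"
proof -
  define l L :: real where "l = ln 2" and "L = ln 3"
  have lL: "0.69314 \<le> l" "l \<le> 0.69315" "1.0986 \<le> L" "L \<le> 1.0987"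
    using ln2_bounds ln3_bounds by (auto simp: l_def L_def)
  have pows: "0.69314^2 \<le> l^2" "l^3 \<le> 0.69315^3" "1.0986^2 \<le> L^2" "L^3 \<le> 1.0987^3"
    using lL by (intro power_mono; simp)+
  have "(1 - g) / (1 + p) - 1 / (1 + p)^2 < - 0.12"
  proof -
    have pp: "p^2 \<le> 1/4" using power_mono[of p "1/2" 2] assms by (simp add: power_divide)
    have sq: "(1 + p)^2 = 1 + 2 * p + p^2" by (simp add: power2_sum)
    have "663/1000 * p + 12/100 * p^2 < 457/1000"
      using assms(2) pp by linarith
    then have 1: "0.423 * (1 + p) - 1 < - 0.12 * (1 + p)^2" unfolding sq by (simp add: field_simps)
    have "(1 - g) * (1 + p) - 1 \<le> 0.423 * (1 + p) - 1"
      using assms by (intro diff_right_mono mult_right_mono) auto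
    also have "\<dots> < - 0.12 * (1 + p)^2"
      by (rule 1)
    finally have "((1 - g) * (1 + p) - 1) / (1 + p)^2 < - 0.12"
      using assms by (simp add: pos_divide_less_eq)
    also have "((1 - g) * (1 + p) - 1) / (1 + p)^2 = (1 - g) / (1 + p) - 1 / (1 + p)^2"
      using assms by (simp add: diff_divide_distrib power2_eq_square)
    finally show ?thesis .
  qed
  also have "- 0.12 \<le> - l / 2 - L / 3 + L^2 / 2
      + p * (l^2 / 4 + L^2 / 6 - L^3 / 6) - p^2 * (l^3 / 12 + L^3 / 18)"
  proof -
    have total: "- 0.12 \<le> - l / 2 - L / 3 + L^2 / 2 + T - U" if "T \<ge> p * 0.1" "U \<le> p * (1/2) * 0.102" for T U
      using that pows lL assms by (simp add: power_divide field_simps)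
    have "p * (l^2 / 4 + L^2 / 6 - L^3 / 6) \<ge> p * 0.1"
      using assms pows by (intro mult_left_mono) (auto simp: power_divide)
    moreover have "l^3 / 12 + L^3 / 18 \<le> 0.102" using pows by (simp add: power_divide)
    then have "p^2 * (l^3 / 12 + L^3 / 18) \<le> (p * (1/2)) * 0.102"
      using assms lL unfolding power2_eq_square
      by (intro mult_mono) auto
    ultimately show ?thesis by (rule total)
  qed
  finally have "1 + p * g + p^2 * ((1 - g) / (1 + p) - 1 / (1 + p)^2) < 1 + p * g + p^2 *
      (- l / 2 - L / 3 + L^2 / 2 + p * (l^2 / 4 + L^2 / 6 - L^3 / 6) - p^2 * (l^3 / 12 + L^3 / 18))"
    using assms by simp
  also have "\<dots> = p * (g - 5/6 + L)
      + p * (1 - p * l + (p * l)^2 / 2 - (p * l)^3 / 6) / 2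
      + p * (1 - p * L + (p * L)^2 / 2 - (p * L)^3 / 6) / 3
      + (1 - p * L + (p * L)^2 / 2 - (p * L)^3 / 6)"
    by (simp add: algebra_simps eval_nat_numeral add_divide_distrib diff_divide_distrib)
  also have "\<dots> \<le> p * (g - 5/6 + ln 3) + p * 2 powr (- p) / 2 + p * 3 powr (- p) / 3 + 3 powr (- p)"
    using powr_minus_Taylor(2)[of 2 p] powr_minus_Taylor(2)[of 3 p] assms unfolding l_def L_def
    by (intro add_mono divide_right_mono mult_left_mono) auto
  finally show ?thesis using target_expansion[of p g 1] assms by simp
qed

text \<open>
  The tangent of a convex function at the integer \<open>a\<close>, with \<open>ln 2\<close> replaced by 0.6932. The constant
  0.9999 in place of 1 pays for this replacement where \<open>s < a\<close>.
\<close>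
lemma two_powr_tangent:
  fixes s :: real
  assumes "s \<ge> real a - 3/2"
  shows "2 powr (- s) \<ge> (0.9999 - 0.6932 * (s - real a)) / 2 ^ a"
proof -
  have "(s - real a + 3/2) * ln 2 \<le> (s - real a + 3/2) * (6932/10000)"
    using ln2_bounds assms by (intro mult_left_mono) auto
  then have "(s - real a) * ln 2 + 3/2 * ln 2 \<le> (s - real a) * (6932/10000) + 3/2 * (6932/10000)"
    by (simp only: distrib_right)
  moreover have "ln 2 \<ge> (69314/100000 :: real)" using ln2_bounds by simp
  ultimately have "9999/10000 - 6932/10000 * (s - real a) \<le> 1 + - ((s - real a) * ln 2)"
    by linarith
  then have "0.9999 - 0.6932 * (s - real a) \<le> 1 + - ((s - real a) * ln 2)" by simp
  also have "\<dots> \<le> exp (- ((s - real a) * ln 2))"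
    by (rule exp_ge_add_one_self)
  also have "\<dots> = 2 powr (- s) * 2 ^ a"
    by (simp add: powr_def left_diff_distrib exp_diff exp_minus field_simps flip: powr_realpow)
  finally show ?thesis by (simp add: pos_divide_le_eq)
qed

text \<open>
  After multiplication by \<open>s^2\<close>, any lower bound \<open>T\<close> for \<open>2 powr (- s)\<close> that makes a certain expression
  positive suffices. The tangents at 2, 3 and 5 serve on \<open>[3/2, 5/2]\<close>, \<open>[5/2, 4]\<close> and \<open>[4, 6]\<close>, and
  \<open>T = 0\<close> serves from 6 on.
\<close>
lemma lower_estimate_away_from_1:
  fixes s g :: real
  assumes s: "s \<ge> 3/2" and g: "g \<le> 0.578"
  shows "s - (1 - g) * ((s - 1) / s) - (s - 1)^2 / s^2 < (s - 1) + 2 powr (- s) * (s + 3) / 2"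
proof -
  have *: "1 < T * (s + 3) / 2 + 0.422 * ((s - 1) / s) + (s - 1)^2 / s^2"
    if "0 < T * (s^2 * (s + 3)) / 2 + 0.422 * (s * (s - 1)) + (s - 1)^2 - s^2" for T
  proof -
    have "0 < (T * (s^2 * (s + 3)) / 2 + 0.422 * (s * (s - 1)) + (s - 1)^2 - s^2) / s^2"
      using that s by simp
    also have "\<dots> = T * (s + 3) / 2 + 0.422 * ((s - 1) / s) + (s - 1)^2 / s^2 - 1"
      using s by (simp add: divide_simps) algebra
    finally show ?thesis by simp
  qed
  have "\<exists>T \<le> 2 powr (- s). 0 < T * (s^2 * (s + 3)) / 2 + 0.422 * (s * (s - 1)) + (s - 1)^2 - s^2"
  proof -
    consider "s \<le> 5/2" | "5/2 \<le> s" "s \<le> 4" | "4 \<le> s" "s \<le> 6" | "6 \<le> s" by linarith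
    then show ?thesis
    proof cases
      case 1
      have Q: "0 \<le> 8665/100000 * s^2 + 3082625/10000000 * s - 40875/100000"
        using 1 s zero_le_power2[of s] by linarith
      \<comment> \<open>In this and the next two cases the quartic to be shown positive is divided by
        \<open>(s - \<alpha>) * (\<beta> - s)\<close>, where \<open>\<alpha>\<close> and \<open>\<beta>\<close> are the end points. The quotient \<open>Q\<close> is nonnegative
        and the linear remainder is positive at both end points.\<close>
      have "0 \<le> (s - 3/2) * (5/2 - s) * (8665/100000 * s^2 + 3082625/10000000 * s - 40875/100000)"
        using 1 s Q by (intro mult_nonneg_nonneg) auto
      then have "0 < (0.9999 - 0.6932 * (s - real 2)) / 2 ^ 2 * (s^2 * (s + 3)) / 2 + 0.422 * (s * (s - 1)) + (s - 1)^2 - s^2"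
        using 1 s by (simp add: field_simps power2_eq_square)
      moreover have "(0.9999 - 0.6932 * (s - real 2)) / 2 ^ 2 \<le> 2 powr (- s)"
        by (rule two_powr_tangent) (use 1 s in simp)
      ultimately show ?thesis by blast
    next
      case 2
      have Q: "0 \<le> 43325/1000000 * s^2 + 21911875/100000000 * s - 8384375/1000000000"
        using 2 s zero_le_power2[of s] by linarith
      have "0 \<le> (s - 5/2) * (4 - s) * (43325/1000000 * s^2 + 21911875/100000000 * s - 8384375/1000000000)"
        using 2 s Q by (intro mult_nonneg_nonneg) auto
      then have "0 < (0.9999 - 0.6932 * (s - real 3)) / 2 ^ 3 * (s^2 * (s + 3)) / 2 + 0.422 * (s * (s - 1)) + (s - 1)^2 - s^2"
        using 2 by (simp add: field_simps power2_eq_square)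
      moreover have "(0.9999 - 0.6932 * (s - real 3)) / 2 ^ 3 \<le> 2 powr (- s)"
        by (rule two_powr_tangent) (use 2 s in simp)
      ultimately show ?thesis by blast
    next
      case 3
      have Q: "0 \<le> 1083125/100000000 * s^2 + 710265625/10000000000 * s - 1810234375/10000000000"
        using 3 s zero_le_power2[of s] by linarith
      have "0 \<le> (s - 4) * (6 - s) * (1083125/100000000 * s^2 + 710265625/10000000000 * s - 1810234375/10000000000)"
        using 3 s Q by (intro mult_nonneg_nonneg) auto
      then have "0 < (0.9999 - 0.6932 * (s - real 5)) / 2 ^ 5 * (s^2 * (s + 3)) / 2 + 0.422 * (s * (s - 1)) + (s - 1)^2 - s^2"
        using 3 by (simp add: field_simps power2_eq_square)
      moreover have "(0.9999 - 0.6932 * (s - real 5)) / 2 ^ 5 \<le> 2 powr (- s)"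
        by (rule two_powr_tangent) (use 3 s in simp)
      ultimately show ?thesis by blast
    next
      case 4
      have "6 * s \<le> s^2" using 4 by (simp add: power2_eq_square)
      then have "0 < 422/1000 * s^2 - 422/1000 * s + (1 - 2 * s)" using 4 by linarith
      also have "\<dots> = 0 * (s^2 * (s + 3)) / 2 + 0.422 * (s * (s - 1)) + (s - 1)^2 - s^2"
        by (simp add: power2_eq_square field_simps)
      finally have "0 < 0 * (s^2 * (s + 3)) / 2 + 0.422 * (s * (s - 1)) + (s - 1)^2 - s^2" .
      then show ?thesis by (intro exI[of _ 0]) auto
    qed
  qed
  then obtain T where T: "T \<le> 2 powr (- s)"
    "1 < T * (s + 3) / 2 + 0.422 * ((s - 1) / s) + (s - 1)^2 / s^2"
    using * by blast
  have "T * (s + 3) \<le> 2 powr (- s) * (s + 3)" using T s by (intro mult_right_mono) auto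
  moreover have "0.422 * ((s - 1) / s) \<le> (1 - g) * ((s - 1) / s)"
    using s g by (intro mult_right_mono) auto
  ultimately show ?thesis using T by linarith
qed

section \<open>The two-sided bound\<close>

theorem theorem1:
  fixes s :: real
  assumes "s > 1"
  shows "s - (1 - euler_mascheroni) * ((s - 1) / s) - (s - 1)^2 / s^2 < (s - 1) * riemann_zeta s
       \<and> (s - 1) * riemann_zeta s < s - (1 - euler_mascheroni) * ((s - 1) / s) - (s - 1)^2 / (3 * s^2)"
proof -
  define p where "p = s - 1"
  have p: "p > 0" and s: "s = 1 + p" using assms by (auto simp: p_def)
  let ?g = "euler_mascheroni :: real"
  have g: "?g \<in> {0.577..0.578}" "?g \<ge> 0.577" "?g \<le> 0.578" using gamma_bounds by auto
  have neg: "- s = - p - 1" "1 - s = - p" by (simp_all add: s)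
  have powr_s: "a powr (- s) = a powr (- p) / a" if "a > 0" for a :: real
    using that unfolding neg powr_diff by simp
  have "1 + p - (1 - ?g) * (p / (1 + p)) - p^2 / (1 + p)^2 < p * riemann_zeta s"
  proof (cases "p \<le> 1/2")
    case True
    have "p * (?g - 5/6 + ln 3 + 2 powr (- p) / 2 + 3 powr (- p) / 3 + 3 powr (- p) / p)
        \<le> p * riemann_zeta s"
      using zeta_ge_gamma_antimono[OF assms] p by (intro mult_left_mono) (simp_all add: powr_s neg(2) flip: p_def)
    moreover have "p * (?g - 5/6 + ln 3 + 2 powr (- p) / 2 + 3 powr (- p) / 3 + 3 powr (- p) / p)
        = p * (?g - 5/6 + ln 3) + p * 2 powr (- p) / 2 + p * 3 powr (- p) / 3 + 3 powr (- p)"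
      using p by (simp add: field_simps)
    moreover note lower_estimate_near_1[OF p True g(2)]
    ultimately show ?thesis unfolding mult_1_left by linarith
  next
    case False
    have "p * (1 + 2 powr (- s) / 2 + 2 powr (- p) / p) \<le> p * riemann_zeta s"
      using zeta_ge_trapezoid[OF assms] p by (intro mult_left_mono) (simp_all add: neg(2) flip: p_def)
    moreover have "p * (1 + 2 powr (- s) / 2 + 2 powr (- p) / p) = p + 2 powr (- s) * (s + 3) / 2"
      using p powr_s[of 2] by (simp add: field_simps) (simp add: s algebra_simps)
    moreover have "1 + p - (1 - ?g) * (p / (1 + p)) - p^2 / (1 + p)^2 < p + 2 powr (- s) * (s + 3) / 2"
      using lower_estimate_away_from_1[of s ?g] False g by (simp add: s)
    ultimately show ?thesis by linarith
  qed
  moreover have "p * riemann_zeta s < 1 + p - (1 - ?g) * (p / (1 + p)) - p^2 / (3 * (1 + p)^2)"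
  proof (cases "p \<le> 2/5")
    case True
    \<comment> \<open>The coefficients of \<open>p\<close> are 3 on the left and about \<open>2 * ln 3 + 5/6 = 3.03\<close> on the right; near
      \<open>p = 0\<close> the least factor that works in place of 5/12 is \<open>3/2 - ln 3\<close>, about 0.4014.\<close>
    have cvx: "2 * (1 + 5/12 * p) * 3 powr (s - 1) \<ge> s * (s + 1)"
    proof -
      have L: "p * (10986/10000) \<le> p * ln 3" using ln3_bounds p by (intro mult_left_mono) auto
      moreover have "(p * (10986/10000))^2 \<le> (p * ln 3)^2" using L p by (intro power_mono) auto
      moreover have "6/10 * p^2 \<le> (p * (10986/10000))^2 / 2"
        by (simp add: power_mult_distrib power_divide mult_le_cancel_right)
      ultimately have "1 + p * (10986/10000) + 6/10 * p^2 \<le> 1 + p * ln 3 + (p * ln 3)^2 / 2"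
        by linarith
      also have "\<dots> \<le> 3 powr (s - 1)"
        using exp_lower_Taylor_quadratic[of "p * ln 3"] p by (simp add: powr_def s)
      finally have "2 * (1 + 5/12 * p) * (1 + p * (10986/10000) + 6/10 * p^2) \<le> 2 * (1 + 5/12 * p) * 3 powr (s - 1)"
        using p by (intro mult_left_mono) auto
      moreover have "2 * (1 + 5/12 * p) * (1 + p * (10986/10000) + 6/10 * p^2)
          = s * (s + 1) + (229/7500 * p + 2231/2000 * p^2 + 1/2 * p^3)"
        by (simp add: s field_simps power2_eq_square power3_eq_cube)
      moreover have "229/7500 * p + 2231/2000 * p^2 + 1/2 * p^3 \<ge> 0" using p by simp
      ultimately show ?thesis by linarith
    qed
    have "p * riemann_zeta s \<le> p * (1 + 2 powr (- p) / 2 + 3 powr (- p) / 6 + 3 powr (- p) / p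
        + (1 + 5/12 * p) * (?g - 5/3 + ln 3))"
      using zeta_le_gamma_trapezoid[OF assms cvx] p
      by (intro mult_left_mono) (simp_all add: powr_s neg(2) flip: p_def)
    also have "\<dots> = p + p * 2 powr (- p) / 2 + p * 3 powr (- p) / 6 + 3 powr (- p)
        + p * (1 + 5/12 * p) * (?g - 5/3 + ln 3)"
      using p by (simp add: field_simps)
    also have "\<dots> < 1 + p - (1 - ?g) * (p / (1 + p)) - 1/3 * (p^2 / (1 + p)^2)"
      by (rule upper_estimate_near_1) (use p True g in auto)
    finally show ?thesis by simp
  next
    case False
    have "p * riemann_zeta s \<le> p * (1 + (3/2) powr (- p) / p)"
      using zeta_le_midpoint[OF assms] p by (intro mult_left_mono) (simp_all add: powr_s neg(2) flip: p_def)
    also have "\<dots> = p + (3/2) powr (- p)" using p by (simp add: field_simps)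
    finally show ?thesis using upper_estimate_away_from_1[of p ?g] False g by simp
  qed
  ultimately show ?thesis by (simp add: s)
qed

end
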